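(* The generating function of the Gaussian Mersenne Lucas numbers is, as an identity of formal power series in $z$ over $\mathbb{C}$, $$\sum_{n=0}^{\infty}Gm_n z^n=\frac{4+3i-(6+5i)z}{2-6z+4z^2}.$$
   Context: Here $i$ is the imaginary unit. The Gaussian Mersenne Lucas numbers $\{Gm_n\}_{n\ge 0}$ are the complex numbers defined by $Gm_0 = 2+\frac{3i}{2}$, $Gm_1 = 3+2i$, and $Gm_n = 3Gm_{n-1}-2Gm_{n-2}$ for $n\ge 2$. *)

theory Defs
  imports Complex_Main "HOL-Computational_Algebra.Formal_Power_Series"
begin

fun Gm :: "nat \<Rightarrow> complex" where
  "Gm 0 = 2 + 3 * \<i> / 2"
| "Gm (Suc 0) = 3 + 2 * \<i>"
| "Gm (Suc (Suc n)) = 3 * Gm (Suc n) - 2 * Gm n"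

end

theory Submission
  imports Defs
begin

text \<open>
  Multiplying the series by \<open>2 - 6z + 4z\<^sup>2\<close>, twice the reciprocal polynomial of the recurrence,
  makes the coefficient of \<open>z^(n+2)\<close> equal to \<open>2 (Gm(n+2) - 3 Gm(n+1) + 2 Gm(n)) = 0\<close>. Only the constant and the
  linear coefficient survive, and the two initial values determine them. The denominator has
  constant term 2, so it is nonzero and can be cancelled.
\<close>

lemma Gm_series_times_denominator:
  "Abs_fps Gm * (2 - 6 * fps_X + 4 * fps_X ^ 2) =
    fps_const (4 + 3 * \<i>) - fps_const (6 + 5 * \<i>) * fps_X"
proof (rule fps_ext)
  fix n
  have expand: "Abs_fps Gm * (2 - 6 * fps_X + 4 * fps_X ^ 2) =
      fps_const 2 * Abs_fps Gm - fps_const 6 * (Abs_fps Gm * fps_X)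
      + fps_const 4 * (Abs_fps Gm * fps_X ^ 2)"
    by (simp add: algebra_simps flip: numeral_fps_const)
  consider "n = 0" | "n = 1" | m where "n = Suc (Suc m)"
    by (metis One_nat_def not0_implies_Suc)
  then show "fps_nth (Abs_fps Gm * (2 - 6 * fps_X + 4 * fps_X ^ 2)) n =
      fps_nth (fps_const (4 + 3 * \<i>) - fps_const (6 + 5 * \<i>) * fps_X) n"
    unfolding expand
    by cases (simp_all add: fps_X_power_mult_right_nth ring_distribs)
qed

theorem theorem4:
  shows "Abs_fps Gm =
    (fps_const (4 + 3 * \<i>) - fps_const (6 + 5 * \<i>) * fps_X) / (2 - 6 * fps_X + 4 * fps_X ^ 2)"
proof -
  have "fps_nth (2 - 6 * fps_X + 4 * fps_X ^ 2 :: complex fps) 0 \<noteq> 0"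
    by (simp add: numeral_fps_const)
  then have "(2 - 6 * fps_X + 4 * fps_X ^ 2 :: complex fps) \<noteq> 0"
    by (metis fps_zero_nth)
  then show ?thesis
    unfolding Gm_series_times_denominator [symmetric]
    by (rule nonzero_mult_div_cancel_right [symmetric])
qed

end
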